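(* Let $n$ be a positive integer. A semisimple element $H\in\mathfrak{sp}(n,\mathbb{C})$ is strongly $\mathrm{Ad}_{\mathrm{Sp}(n,\mathbb{C})}$-real if and only if the multiplicity of each non-zero eigenvalue of $H$ is even.
   Context: Let $\mathrm{J}_n=\begin{pmatrix}0&-\mathrm{I}_n\\ \mathrm{I}_n&0\end{pmatrix}$. Then $\mathrm{Sp}(n,\mathbb{C})=\{g\in\mathrm{SL}_{2n}(\mathbb{C}) : g^t\mathrm{J}_n g=\mathrm{J}_n\}$, with Lie algebra $\mathfrak{sp}(n,\mathbb{C})=\{z\in\mathfrak{sl}_{2n}(\mathbb{C}) : z^t\mathrm{J}_n+\mathrm{J}_n z=0\}$. An element is semisimple if it is diagonalizable as a complex $2n\times 2n$ matrix; eigenvalues and multiplicities are those of this $2n\times 2n$ matrix. For a Lie group $G$ with Lie algebra $\mathfrak{g}$, an element $X\in\mathfrak{g}$ is called $\mathrm{Ad}_G$-real if $-X=\mathrm{Ad}(g)X$ for some $g\in G$. An $\mathrm{Ad}_G$-real element $X$ is called strongly $\mathrm{Ad}_G$-real if $-X=\mathrm{Ad}(\tau)X$ for some $\tau\in G$ with $\tau^2=\mathrm{Id}$. For a linear Lie group, $\mathrm{Ad}(g)X=gXg^{-1}$. *)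

theory Defs
  imports "Jordan_Normal_Form.Char_Poly" "Jordan_Normal_Form.Gauss_Jordan_Elimination"
begin

definition trace_mat :: "'a :: comm_monoid_add mat \<Rightarrow> 'a" where
  "trace_mat A = (\<Sum>i<dim_row A. A $$ (i, i))"

definition J_mat :: "nat \<Rightarrow> complex mat" where
  "J_mat n = four_block_mat (0\<^sub>m n n) (- (1\<^sub>m n)) (1\<^sub>m n) (0\<^sub>m n n)"

definition SL_complex :: "nat \<Rightarrow> complex mat set" where
  "SL_complex m = {g \<in> carrier_mat m m. det g = 1}"

definition sl_complex :: "nat \<Rightarrow> complex mat set" where
  "sl_complex m = {z \<in> carrier_mat m m. trace_mat z = 0}"

definition Sp_complex :: "nat \<Rightarrow> complex mat set" where
  "Sp_complex n = {g \<in> SL_complex (2 * n). transpose_mat g * J_mat n * g = J_mat n}"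

definition sp_complex :: "nat \<Rightarrow> complex mat set" where
  "sp_complex n =
     {z \<in> sl_complex (2 * n). transpose_mat z * J_mat n + J_mat n * z = 0\<^sub>m (2 * n) (2 * n)}"

definition diagonalizable_mat :: "'a :: semiring_1 mat \<Rightarrow> bool" where
  "diagonalizable_mat A \<longleftrightarrow> (\<exists>D. diagonal_mat D \<and> similar_mat A D)"

(* The algebraic multiplicity; for diagonalizable matrices it coincides with the geometric one. *)
definition eigenvalue_mult :: "complex mat \<Rightarrow> complex \<Rightarrow> nat" where
  "eigenvalue_mult A \<mu> = order \<mu> (char_poly A)"

(* Only meaningful for invertible g: otherwise mat_inverse g is None. *)
definition Ad :: "complex mat \<Rightarrow> complex mat \<Rightarrow> complex mat" where
  "Ad g X = g * X * the (mat_inverse g)"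

(* In the next two definitions G is a linear Lie group, given by its set of matrices, and X is
   meant to be an element of its Lie algebra. *)
definition Ad_real :: "complex mat set \<Rightarrow> complex mat \<Rightarrow> bool" where
  "Ad_real G X \<longleftrightarrow> (\<exists>g\<in>G. - X = Ad g X)"

definition strongly_Ad_real :: "complex mat set \<Rightarrow> complex mat \<Rightarrow> bool" where
  "strongly_Ad_real G X \<longleftrightarrow>
     Ad_real G X \<and> (\<exists>\<tau>\<in>G. - X = Ad \<tau> X \<and> \<tau> ^\<^sub>m 2 = 1\<^sub>m (dim_row X))"

end

theory Submission
  imports Defs
begin

text \<open>
  Diagonalise \<open>H = R D R\<^sup>-\<^sup>1\<close> and transport the symplectic form to the eigenbasis:
  \<open>\<Omega> = R\<^sup>T J R\<close> is antisymmetric and invertible, and \<open>H \<in> sp\<close> becomes \<open>D \<Omega> = - \<Omega> D\<close>. So \<open>\<Omega>\<close>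
  pairs the \<open>\<mu>\<close>-eigenspace with the \<open>-\<mu>\<close>-eigenspace and vanishes on all other pairs of
  eigenspaces.

  If a symplectic involution \<open>\<tau>\<close> satisfies \<open>\<tau> H \<tau>\<^sup>-\<^sup>1 = - H\<close>, then the form
  \<open>(x, y) \<mapsto> \<omega>(x, \<tau> y)\<close> is alternating, because \<open>\<tau>\<close> is its own inverse, and nondegenerate. As \<open>\<tau>\<close>
  exchanges the eigenspaces for \<open>\<mu>\<close> and \<open>-\<mu>\<close>, distinct eigenspaces are orthogonal for this
  form. Its restriction to each eigenspace is therefore a nondegenerate alternating form, which
  forces an even dimension (\<open>even_fibre_if_antisymmetric_commutes\<close>).

  Conversely, suppose that the multiplicities are even. Choose one of \<open>\<mu>\<close>, \<open>-\<mu>\<close> for every nonzero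
  eigenvalue and put a nondegenerate alternating form \<open>K\<close> with \<open>K\<^sup>2 = - 1\<close> on the chosen
  eigenspaces (\<open>antisymmetric_root_on_fibres\<close>). Composing with \<open>\<Omega>\<^sup>-\<^sup>1\<close> turns it into a map
  \<open>\<Omega>\<^sup>-\<^sup>1 K\<close> from the chosen eigenspaces to the opposite ones, whose inverse is \<open>- K \<Omega>\<close>. The two
  maps together with the identity on the kernel of \<open>D\<close> form the required involution
  (\<open>symplectic_sign_reversing_involution\<close>). Its determinant is a sign, given by the number of
  opposite eigenvalues counted with multiplicity (\<open>block_swap_involution\<close>), and this number is
  even.
\<close>

section \<open>Diagonal matrices\<close>

lemma order_prod_list_linear:
  fixes xs :: "'a :: idom list"
  shows "order \<mu> (\<Prod>a\<leftarrow>xs. [:- a, 1:]) = length (filter (\<lambda>a. a = \<mu>) xs)"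
proof (induction xs)
  case (Cons a xs)
  have nz: "[:- a, 1:] * (\<Prod>a\<leftarrow>xs. [:- a, 1:]) \<noteq> 0"
    by (auto simp: prod_list_zero_iff simp del: mult_pCons_left)
  have "order \<mu> [:- a, 1:] = (if a = \<mu> then 1 else 0)"
    using order_linear_power[of \<mu> "- a" 1] by auto
  then show ?case
    using Cons order_mult[OF nz, of \<mu>] by (simp del: mult_pCons_left)
qed simp

lemma order_char_poly_similar_mat_diag:
  fixes d :: "nat \<Rightarrow> 'a :: idom"
  assumes "similar_mat A (mat_diag m d)"
  shows "order \<mu> (char_poly A) = card {i. i < m \<and> d i = \<mu>}"
proof -
  have "upper_triangular (mat_diag m d)"
    by (auto simp: mat_diag_def)
  moreover have "diag_mat (mat_diag m d) = map d [0..<m]"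
    by (auto simp: diag_mat_def mat_diag_def)
  ultimately have "char_poly A = (\<Prod>a\<leftarrow>map d [0..<m]. [:- a, 1:])"
    using char_poly_similar[OF assms] char_poly_upper_triangular[OF mat_diag_dim] by metis
  then have "order \<mu> (char_poly A) = length (filter (\<lambda>a. a = \<mu>) (map d [0..<m]))"
    by (simp only: order_prod_list_linear)
  also have "\<dots> = card {i. i < m \<and> d i = \<mu>}"
    by (auto simp: length_filter_conv_card intro!: arg_cong[of _ _ card])
  finally show ?thesis .
qed

lemma det_mat_diag: "det (mat_diag m f) = (\<Prod>i<m. f i)"
proof -
  have "upper_triangular (mat_diag m f)"
    by (auto simp: mat_diag_def)
  moreover have "diag_mat (mat_diag m f) = map f [0..<m]"
    by (auto simp: diag_mat_def mat_diag_def)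
  ultimately have "det (mat_diag m f) = prod_list (map f [0..<m])"
    using det_upper_triangular[OF _ mat_diag_dim] by metis
  also have "\<dots> = (\<Prod>i<m. f i)"
    by (simp add: prod.list_conv_set_nth atLeast0LessThan)
  finally show ?thesis .
qed

lemma prod_signs:
  fixes m :: nat
  shows
  "(\<Prod>i<m. if Q i then - 1 else 1 :: 'a :: comm_ring_1) = (- 1) ^ card {i. i < m \<and> Q i}"
proof -
  have "{..<m} \<inter> {i. Q i} = {i. i < m \<and> Q i}" by auto
  moreover have "{i \<in> {..<m}. Q i} = {i. i < m \<and> Q i}" by auto
  ultimately show ?thesis
    using prod.inter_filter[of "{..<m}" "\<lambda>_. - 1 :: 'a" Q] by simp
qed

text \<open>
  The hypothesis on \<open>A\<close> says that \<open>A\<close> has a nonzero entry only where the entries of \<open>d\<close> and \<open>e\<close>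
  agree. Hence functions of the eigenvalues, in particular projections onto sums of eigenspaces,
  can be moved past \<open>A\<close> as well.
\<close>

lemma mat_diag_intertwine:
  fixes A :: "'a :: field mat"
  assumes A: "A \<in> carrier_mat m m"
    and eq: "mat_diag m d * A = A * mat_diag m e"
    and refine: "\<And>i j. \<lbrakk>i < m; j < m; d i = e j\<rbrakk> \<Longrightarrow> f i = g j"
  shows "mat_diag m f * A = A * mat_diag m g"
proof (rule eq_matI)
  fix i j assume "i < dim_row (A * mat_diag m g)" "j < dim_col (A * mat_diag m g)"
  then have ij: "i < m" "j < m" using A by (auto simp: mat_diag_def)
  have "(mat_diag m d * A) $$ (i, j) = (A * mat_diag m e) $$ (i, j)" using eq by simp
  then have "d i * A $$ (i, j) = A $$ (i, j) * e j"
    using ij A by (simp add: mat_diag_mult_left[OF A] mat_diag_mult_right[OF A])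
  then have "f i * A $$ (i, j) = A $$ (i, j) * g j"
    using refine[OF ij] by (cases "A $$ (i, j) = 0") auto
  then show "(mat_diag m f * A) $$ (i, j) = (A * mat_diag m g) $$ (i, j)"
    using ij A by (simp add: mat_diag_mult_left[OF A] mat_diag_mult_right[OF A])
qed (use A in \<open>auto simp: mat_diag_def\<close>)

section \<open>Alternating forms on eigenspaces\<close>

text \<open>
  \<open>S\<close> is block diagonal with respect to the fibres of \<open>d\<close>, and its block at \<open>\<mu>\<close> is
  antisymmetric and invertible. To avoid submatrices, this block is completed by an identity
  matrix to an invertible \<open>m \<times> m\<close> matrix \<open>A\<close>. Transposing \<open>A\<close> changes the sign of exactly the
  columns in the fibre of \<open>\<mu>\<close>, so \<open>det A = (-1)\<^sup>k det A\<close> with \<open>k\<close> the size of the fibre.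
\<close>

lemma even_fibre_if_antisymmetric_commutes:
  fixes S :: "'a :: field_char_0 mat"
  assumes S: "S \<in> carrier_mat m m" and T: "T \<in> carrier_mat m m"
    and inv: "S * T = 1\<^sub>m m"
    and anti: "transpose_mat S = - S"
    and comm: "mat_diag m d * S = S * mat_diag m d"
  shows "even (card {i. i < m \<and> d i = \<mu>})"
proof -
  define E where "E = mat_diag m (\<lambda>i. if d i = \<mu> then 1 else 0 :: 'a)"
  define F where "F = mat_diag m (\<lambda>i. if d i = \<mu> then 0 else 1 :: 'a)"
  define R where "R = mat_diag m (\<lambda>i. if d i = \<mu> then - 1 else 1 :: 'a)"
  have [simp]: "E \<in> carrier_mat m m" "F \<in> carrier_mat m m" "R \<in> carrier_mat m m"
    by (simp_all add: E_def F_def R_def)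
  note carrs = S T \<open>E \<in> _\<close> \<open>F \<in> _\<close> \<open>R \<in> _\<close>
  note [simp] = carrs carrs[THEN carrier_matD(1)] carrs[THEN carrier_matD(2)]
  have ER: "E * R = - E" and FR: "F * R = F" and FE: "F * E = 0\<^sub>m m m" and EF: "E * F = 0\<^sub>m m m"
    and EE: "E * E = E" and FF: "F * F = F" and EpF: "E + F = 1\<^sub>m m"
    and tr: "transpose_mat E = E" "transpose_mat F = F"
    unfolding E_def F_def R_def mat_diag_diag by (auto simp: mat_diag_def intro!: eq_matI)
  have ES: "E * S = S * E" and FS: "F * S = S * F"
    unfolding E_def F_def by (rule mat_diag_intertwine[OF S comm]; simp)+
  note [simp] = mult_carrier_mat[of _ m m _ m]
  note dist = assoc_mult_mat[of _ m m _ m _ m] add_mult_distrib_mat[of _ m m _ _ m]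
    mult_add_distrib_mat[of _ m m _ m]
  define A where "A = S * E + F"
  have A: "A \<in> carrier_mat m m" by (simp add: A_def)
  have "transpose_mat A = - (E * S) + F"
    unfolding A_def transpose_add[OF mult_carrier_mat[OF S \<open>E \<in> _\<close>] \<open>F \<in> _\<close>]
      transpose_mult[OF S \<open>E \<in> _\<close>] by (simp add: anti tr)
  also have "\<dots> = A * R"
    unfolding A_def by (simp add: dist ER FR ES)
  finally have "det A = det A * det R"
    using det_transpose[OF A] det_mult[OF A, of R] by simp
  moreover have "det A \<noteq> 0"
  proof -
    have "A * (E * T + F) = S * (E * (E * T)) + F"
    proof -
      have "F * (E * T) = (F * E) * T" by (simp add: dist)
      then have "F * (E * T) = 0\<^sub>m m m" by (simp add: FE)
      then show ?thesis unfolding A_def by (simp add: dist EF FF)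
    qed
    also have "S * (E * (E * T)) = (S * E) * T"
      by (simp add: EE flip: assoc_mult_mat[of _ m m _ m _ m])
    also have "\<dots> = E * (S * T)" by (simp add: dist flip: ES)
    finally have "A * (E * T + F) = 1\<^sub>m m" by (simp add: inv EpF)
    then have "det A * det (E * T + F) = 1"
      using det_mult[OF A, of "E * T + F"] by simp
    then show ?thesis by auto
  qed
  ultimately have "det R = 1" by simp
  then have "(- 1 :: 'a) ^ card {i. i < m \<and> d i = \<mu>} = 1"
    by (simp add: R_def det_mat_diag prod_signs)
  then show ?thesis by (metis neg_one_odd_power one_neq_neg_one)
qed

text \<open>
  A combinatorial form of a symplectic basis: \<open>\<pi>\<close> exchanges the two partners of each hyperbolic
  pair inside a fibre, and \<open>\<epsilon>\<close> tells them apart. The proof removes one pair from one fibre at a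
  time.
\<close>

lemma sign_pairing_of_even_fibres:
  fixes d :: "nat \<Rightarrow> 'b"
  assumes "finite A" and "\<And>\<mu>. even (card {i \<in> A. d i = \<mu>})"
  shows "\<exists>\<pi> \<epsilon>. \<forall>i\<in>A. \<pi> i \<in> A \<and> \<pi> (\<pi> i) = i \<and> d (\<pi> i) = d i
           \<and> \<epsilon> i * \<epsilon> i = (1 :: 'a :: comm_ring_1) \<and> \<epsilon> (\<pi> i) = - \<epsilon> i"
  using assms
proof (induction "card A" arbitrary: A rule: less_induct)
  case less
  show ?case
  proof (cases "A = {}")
    case False
    then obtain a where a: "a \<in> A" by auto
    let ?F = "{i \<in> A. d i = d a}"
    have "?F \<noteq> {a}" using less.prems(2)[of "d a"] by (metis card_1_singleton_iff is_singletonI is_singleton_altdef odd_one)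
    then obtain b where b: "b \<in> A" "b \<noteq> a" "d b = d a" using a by blast
    let ?A = "A - {a, b}"
    have "even (card {i \<in> ?A. d i = \<mu>})" for \<mu>
    proof (cases "\<mu> = d a")
      case True
      then have "{i \<in> ?A. d i = \<mu>} = {i \<in> A. d i = \<mu>} - {a, b}" by auto
      moreover have "card ({i \<in> A. d i = \<mu>} - {a, b}) = card {i \<in> A. d i = \<mu>} - card {a, b}"
        by (rule card_Diff_subset) (use a b True in auto)
      ultimately show ?thesis using less.prems(2)[of \<mu>] b by simp
    next
      case False
      then have "{i \<in> ?A. d i = \<mu>} = {i \<in> A. d i = \<mu>}" using b by auto
      then show ?thesis using less.prems(2)[of \<mu>] by metis
    qed
    moreover have "card ?A < card A" using a less.prems(1) by (intro psubset_card_mono) auto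
    ultimately obtain \<pi> and \<epsilon> :: "nat \<Rightarrow> 'a" where
      ih: "\<forall>i\<in>?A. \<pi> i \<in> ?A \<and> \<pi> (\<pi> i) = i \<and> d (\<pi> i) = d i \<and> \<epsilon> i * \<epsilon> i = 1 \<and> \<epsilon> (\<pi> i) = - \<epsilon> i"
      using less.hyps[of ?A] less.prems(1) by blast
    show ?thesis
      by (rule exI[of _ "\<pi>(a := b, b := a)"], rule exI[of _ "\<epsilon>(a := 1, b := - 1)"])
        (use ih a b in auto)
  qed simp
qed

text \<open>
  On the indices whose value satisfies \<open>Q\<close>, \<open>K\<close> is the signed permutation matrix of a pairing, a
  complex structure that is also antisymmetric; elsewhere it is zero.
\<close>

lemma antisymmetric_root_on_fibres:
  fixes d :: "nat \<Rightarrow> 'a :: field"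
  assumes "\<And>\<mu>. Q \<mu> \<Longrightarrow> even (card {i. i < m \<and> d i = \<mu>})"
    and E_def: "E = mat_diag m (\<lambda>i. if Q (d i) then 1 else 0)"
  obtains K where "K \<in> carrier_mat m m" "transpose_mat K = - K" "K * K = - E"
    "E * K = K" "K * E = K" "mat_diag m d * K = K * mat_diag m d"
proof -
  define A where "A = {i. i < m \<and> Q (d i)}"
  have "even (card {i \<in> A. d i = \<mu>})" for \<mu>
  proof (cases "Q \<mu>")
    case True
    then have "{i \<in> A. d i = \<mu>} = {i. i < m \<and> d i = \<mu>}" by (auto simp: A_def)
    then show ?thesis using assms(1)[OF True] by simp
  next
    case False
    then have "{i \<in> A. d i = \<mu>} = {}" by (auto simp: A_def)
    then show ?thesis by (metis card.empty even_zero)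
  qed
  moreover have "finite A" by (simp add: A_def)
  ultimately obtain \<pi> and \<epsilon> :: "nat \<Rightarrow> 'a" where
    pi: "\<forall>i\<in>A. \<pi> i \<in> A \<and> \<pi> (\<pi> i) = i \<and> d (\<pi> i) = d i \<and> \<epsilon> i * \<epsilon> i = 1 \<and> \<epsilon> (\<pi> i) = - \<epsilon> i"
    using sign_pairing_of_even_fibres[of A d, where 'a = 'a] by blast
  define K where "K = mat m m (\<lambda>(i, j). if i \<in> A \<and> j = \<pi> i then \<epsilon> i else 0)"
  have K: "K \<in> carrier_mat m m" by (simp add: K_def)
  have Am: "i < m" if "i \<in> A" for i using that by (simp add: A_def)
  have EA: "E = mat_diag m (\<lambda>i. if i \<in> A then 1 else 0)"
    unfolding E_def mat_diag_def by (rule eq_matI) (auto simp: A_def)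
  show thesis
  proof (rule that[OF K])
    show "transpose_mat K = - K"
      by (rule eq_matI) (use pi in \<open>auto simp: K_def\<close>)
    show "K * K = - E"
    proof (rule eq_matI)
      fix i j assume "i < dim_row (- E)" "j < dim_col (- E)"
      then have ij: "i < m" "j < m" by (auto simp: E_def mat_diag_def)
      have "(K * K) $$ (i, j) = (\<Sum>k<m. K $$ (i, k) * K $$ (k, j))"
        using ij K by (simp add: scalar_prod_def atLeast0LessThan)
      also have "\<dots> = (\<Sum>k<m. if k = \<pi> i then (if i \<in> A then \<epsilon> i * K $$ (\<pi> i, j) else 0) else 0)"
        by (rule sum.cong) (use ij in \<open>auto simp: K_def\<close>)
      also have "\<dots> = (if i \<in> A then \<epsilon> i * K $$ (\<pi> i, j) else 0)"
        using pi Am by auto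
      also have "\<dots> = (- E) $$ (i, j)"
        using ij pi Am by (auto simp: K_def EA mat_diag_def)
      finally show "(K * K) $$ (i, j) = (- E) $$ (i, j)" .
    qed (use K in \<open>auto simp: E_def mat_diag_def\<close>)
    show "E * K = K"
      unfolding EA mat_diag_mult_left[OF K] by (rule eq_matI) (auto simp: K_def)
    show "K * E = K"
      unfolding EA mat_diag_mult_right[OF K] by (rule eq_matI) (use pi in \<open>auto simp: K_def\<close>)
    show "mat_diag m d * K = K * mat_diag m d"
      unfolding mat_diag_mult_left[OF K] mat_diag_mult_right[OF K]
      by (rule eq_matI) (use pi in \<open>auto simp: K_def\<close>)
  qed
qed

section \<open>The involution built from an alternating form\<close>

lemma even_card_if_even_fibres:
  assumes "finite A" and "\<And>\<mu>. even (card {i \<in> A. d i = \<mu>})"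
  shows "even (card A)"
proof -
  have "card A = (\<Sum>\<mu>\<in>d ` A. card {i \<in> A. d i = \<mu>})"
    using sum.image_gen[OF assms(1), of "\<lambda>_. 1 :: nat" d] by simp
  then show ?thesis using assms(2) by (simp add: dvd_sum)
qed

text \<open>
  \<open>N\<close> maps the image of the projection \<open>P\<close> onto that of \<open>Q\<close>, and \<open>M\<close> is the inverse map. The
  involution exchanging the two images along \<open>N\<close> and \<open>M\<close> has the eigenvectors \<open>x + N x\<close> for \<open>1\<close> (with
  \<open>x\<close> in the image of \<open>P\<close>) and \<open>y - M y\<close> for \<open>-1\<close> (with \<open>y\<close> in the image of \<open>Q\<close>), so its
  determinant is that of \<open>1\<close> on \<open>Z + P\<close> and \<open>-1\<close> on \<open>Q\<close>.
\<close>

lemma block_swap_involution: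
  fixes N M :: "'a :: field_char_0 mat"
  assumes N: "N \<in> carrier_mat m m" and M: "M \<in> carrier_mat m m"
    and disj: "\<And>i. i < m \<Longrightarrow> \<not> (p i \<and> q i)"
    and P_def: "P = mat_diag m (\<lambda>i. if p i then 1 else 0)"
    and Q_def: "Q = mat_diag m (\<lambda>i. if q i then 1 else 0)"
    and Z_def: "Z = mat_diag m (\<lambda>i. if p i \<or> q i then 0 else 1)"
    and QN: "Q * N = N" and NP: "N * P = N" and PM: "P * M = M" and MQ: "M * Q = M"
    and NM: "N * M = Q" and MN: "M * N = P"
  shows "(Z + N + M) * (Z + N + M) = 1\<^sub>m m"
    and "det (Z + N + M) = (- 1) ^ card {i. i < m \<and> q i}"
proof -
  have "P \<in> carrier_mat m m" "Q \<in> carrier_mat m m" "Z \<in> carrier_mat m m"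
    by (simp_all add: P_def Q_def Z_def)
  note carrs = this N M
  note [simp] = carrs carrs[THEN carrier_matD(1)] carrs[THEN carrier_matD(2)]
  note [simp] = mult_carrier_mat[of _ m m _ m]
  note assoc = assoc_mult_mat[of _ m m _ m _ m]
  note dist = assoc add_mult_distrib_mat[of _ m m _ _ m] mult_add_distrib_mat[of _ m m _ m]
  have diag0: "P * Q = 0\<^sub>m m m" "Q * P = 0\<^sub>m m m" "Z * P = 0\<^sub>m m m" "Z * Q = 0\<^sub>m m m"
    "P * Z = 0\<^sub>m m m" "Q * Z = 0\<^sub>m m m" "Z * Z = Z"
    unfolding P_def Q_def Z_def mat_diag_diag
    by (rule eq_matI; use disj in \<open>force simp: mat_diag_def\<close>)+
  have "N * N = (N * P) * (Q * N)" by (simp only: NP QN)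
  also have "\<dots> = N * (P * Q) * N" by (simp add: assoc)
  finally have NN: "N * N = 0\<^sub>m m m" by (simp add: diag0)
  have "M * M = (M * Q) * (P * M)" by (simp only: PM MQ)
  also have "\<dots> = M * (Q * P) * M" by (simp add: assoc)
  finally have MM: "M * M = 0\<^sub>m m m" by (simp add: diag0)
  have "Z * N = Z * Q * N" by (simp add: assoc QN)
  then have ZN: "Z * N = 0\<^sub>m m m" by (simp add: diag0)
  have "N * Z = N * (P * Z)" by (simp add: NP flip: assoc)
  then have NZ: "N * Z = 0\<^sub>m m m" by (simp add: diag0)
  have "Z * M = Z * P * M" by (simp add: assoc PM)
  then have ZM: "Z * M = 0\<^sub>m m m" by (simp add: diag0)
  have "M * Z = M * (Q * Z)" by (simp add: MQ flip: assoc)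
  then have MZ: "M * Z = 0\<^sub>m m m" by (simp add: diag0)
  have "N * Q = N * (P * Q)" by (simp add: NP flip: assoc)
  then have NQ: "N * Q = 0\<^sub>m m m" by (simp add: diag0)
  have "M * P = M * (Q * P)" by (simp add: MQ flip: assoc)
  then have MP: "M * P = 0\<^sub>m m m" by (simp add: diag0)
  note mults = dist diag0 NN MM NM MN ZN NZ ZM MZ NQ MP NP MQ

  have "(Z + N + M) * (Z + N + M) = Z + Q + P"
    by (simp add: mults) (auto intro!: eq_matI)
  also have "\<dots> = 1\<^sub>m m"
    by (rule eq_matI; use disj in \<open>force simp: P_def Q_def Z_def mat_diag_def\<close>)
  finally show "(Z + N + M) * (Z + N + M) = 1\<^sub>m m" .

  \<comment> \<open>The columns of \<open>C\<close> are the eigenvectors of the involution, \<open>R\<close> lists their eigenvalues.\<close>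
  define C where "C = 1\<^sub>m m + N + - M"
  define R where "R = Z + P + - Q"
  have CR[simp]: "C \<in> carrier_mat m m" "R \<in> carrier_mat m m"
    unfolding C_def R_def by auto
  have "(Z + N + M) * C = C * R"
    unfolding C_def R_def by (simp add: mults) (auto intro!: eq_matI)
  then have "det (Z + N + M) * det C = det C * det R"
    using det_mult[of "Z + N + M" m C] det_mult[of C m R] by (metis CR M add_carrier_mat)
  moreover have "det C \<noteq> 0"
  proof -
    \<comment> \<open>Since \<open>(N - M)\<^sup>2 = - (P + Q)\<close>, the product of \<open>1 + (N - M)\<close> and \<open>1 - (N - M)\<close> is diagonal.\<close>
    have "C * (1\<^sub>m m + - N + M) = 1\<^sub>m m + Q + P"
      unfolding C_def by (simp add: mults) (auto intro!: eq_matI)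
    also have "\<dots> = mat_diag m (\<lambda>i. if p i \<or> q i then 2 else 1)"
      by (rule eq_matI; use disj in \<open>force simp: P_def Q_def mat_diag_def\<close>)
    finally have "det C * det (1\<^sub>m m + - N + M) = (\<Prod>i<m. if p i \<or> q i then 2 else 1)"
      using det_mult[of C m "1\<^sub>m m + - N + M"] by (simp add: det_mat_diag)
    moreover have "(\<Prod>i<m. if p i \<or> q i then 2 else 1 :: 'a) \<noteq> 0" by simp
    ultimately show ?thesis by auto
  qed
  moreover have "R = mat_diag m (\<lambda>i. if q i then - 1 else 1)"
    unfolding R_def
    by (rule eq_matI; use disj in \<open>force simp: P_def Q_def Z_def mat_diag_def\<close>)
  ultimately show "det (Z + N + M) = (- 1) ^ card {i. i < m \<and> q i}"
    by (simp add: det_mat_diag prod_signs)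
qed

text \<open>
  Half of the nonzero complex numbers: the open upper half plane together with the positive real
  axis, so that it contains exactly one of \<open>z\<close> and \<open>-z\<close> for every nonzero \<open>z\<close>.
\<close>

definition in_upper_half :: "complex \<Rightarrow> bool" where
  "in_upper_half z \<longleftrightarrow> Im z > 0 \<or> Im z = 0 \<and> Re z > 0"

lemma in_upper_half_cases:
  "z = 0 \<longleftrightarrow> \<not> (in_upper_half z \<or> in_upper_half (- z))"
  "\<not> (in_upper_half z \<and> in_upper_half (- z))"
  by (auto simp: in_upper_half_def complex_eq_iff)

text \<open>
  The matrix of the form \<open>(x, y) \<mapsto> \<omega>(x, \<tau> y)\<close> is \<open>\<Omega> \<tau>\<close>. It is prescribed to be the alternating
  form \<open>K\<close> on the eigenspaces in the upper half and \<open>\<Omega>\<close> itself on the kernel of \<open>D\<close>; the requirement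
  \<open>\<tau>\<^sup>2 = 1\<close> then leaves only \<open>- \<Omega> K \<Omega>\<close> on the opposite eigenspaces. For an involution \<open>\<tau>\<close>,
  antisymmetry of \<open>\<Omega> \<tau>\<close> is equivalent to \<open>\<tau>\<close> being symplectic.
\<close>

lemma symplectic_sign_reversing_involution:
  fixes d :: "nat \<Rightarrow> complex"
  assumes Om: "\<Omega> \<in> carrier_mat m m" and W: "W \<in> carrier_mat m m"
    and OW: "\<Omega> * W = 1\<^sub>m m" and WO: "W * \<Omega> = 1\<^sub>m m"
    and anti: "transpose_mat \<Omega> = - \<Omega>"
    and rev: "mat_diag m d * \<Omega> = - (\<Omega> * mat_diag m d)"
    and ev: "\<And>\<mu>. \<mu> \<noteq> 0 \<Longrightarrow> even (card {i. i < m \<and> d i = \<mu>})"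
  obtains \<tau> where "\<tau> \<in> carrier_mat m m" "\<tau> * \<tau> = 1\<^sub>m m" "det \<tau> = 1"
    "transpose_mat \<tau> * \<Omega> * \<tau> = \<Omega>" "\<tau> * mat_diag m d = - (mat_diag m d * \<tau>)"
proof -
  define D where "D = mat_diag m d"
  define p where "p i = in_upper_half (d i)" for i
  define q where "q i = in_upper_half (- d i)" for i
  define P where "P = mat_diag m (\<lambda>i. if p i then 1 else 0 :: complex)"
  define Q where "Q = mat_diag m (\<lambda>i. if q i then 1 else 0 :: complex)"
  define Z where "Z = mat_diag m (\<lambda>i. if p i \<or> q i then 0 else 1 :: complex)"
  note halves = in_upper_half_cases
  have ev_upper: "even (card {i. i < m \<and> d i = \<mu>})" if "in_upper_half \<mu>" for \<mu>
    using ev[of \<mu>] that halves(1)[of \<mu>] by blast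
  obtain K where K: "K \<in> carrier_mat m m" and Kt: "transpose_mat K = - K"
    and KK: "K * K = - P" and PK: "P * K = K" and KP: "K * P = K" and DK: "D * K = K * D"
    using antisymmetric_root_on_fibres[OF ev_upper P_def[unfolded p_def], folded D_def] by blast
  have "D \<in> carrier_mat m m" "P \<in> carrier_mat m m" "Q \<in> carrier_mat m m" "Z \<in> carrier_mat m m"
    by (simp_all add: D_def P_def Q_def Z_def)
  note carrs = this Om W K
  note [simp] = carrs carrs[THEN carrier_matD(1)] carrs[THEN carrier_matD(2)]
  note [simp] = mult_carrier_mat[of _ m m _ m]
  note assoc = assoc_mult_mat[of _ m m _ m _ m]
  note dist = assoc add_mult_distrib_mat[of _ m m _ _ m] mult_add_distrib_mat[of _ m m _ m]
  have uD: "mat_diag m (\<lambda>i. - d i) = - D"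
    by (auto simp: D_def mat_diag_def)
  have rO: "mat_diag m d * \<Omega> = \<Omega> * mat_diag m (\<lambda>i. - d i)"
    using rev by (simp add: uD flip: D_def)
  have DO: "D * \<Omega> = - (\<Omega> * D)" using rev by (simp add: D_def)
  have "D * W = W * (\<Omega> * D) * W" by (simp add: WO flip: assoc)
  also have "\<Omega> * D = - (D * \<Omega>)" by (simp add: DO)
  also have "W * - (D * \<Omega>) * W = - (W * D)" by (simp add: assoc OW)
  finally have DW: "D * W = - (W * D)" .
  then have rW: "mat_diag m d * W = W * mat_diag m (\<lambda>i. - d i)"
    by (simp add: uD flip: D_def)
  have refine_p: "p i = q j" and refine_q: "q i = p j" if "d i = - d j" for i j
    using that by (simp_all add: p_def q_def)
  have PO: "P * \<Omega> = \<Omega> * Q" and ZO: "Z * \<Omega> = \<Omega> * Z"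
    unfolding P_def Q_def Z_def
    by (rule mat_diag_intertwine[OF Om rO]; use refine_p refine_q in metis)+
  have PW: "P * W = W * Q" and QW: "Q * W = W * P"
    unfolding P_def Q_def
    by (rule mat_diag_intertwine[OF W rW]; use refine_p refine_q in metis)+
  have disj: "\<not> (p i \<and> q i)" for i using halves by (simp add: p_def q_def)

  define N where "N = W * K"
  define M where "M = - (K * \<Omega>)"
  have "N \<in> carrier_mat m m" "M \<in> carrier_mat m m" unfolding N_def M_def by auto
  note carrs = this
  note [simp] = carrs carrs[THEN carrier_matD(1)] carrs[THEN carrier_matD(2)]
  have "Q * N = Q * W * K" by (simp add: N_def assoc)
  also have "\<dots> = W * (P * K)" by (simp add: QW assoc)
  finally have QN: "Q * N = N" by (simp add: PK N_def)
  have NP: "N * P = N" by (simp add: N_def assoc KP)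
  have PM: "P * M = M" by (simp add: M_def PK flip: assoc)
  have MQ: "M * Q = M"
    by (simp add: M_def assoc flip: PO) (simp add: KP flip: assoc)
  have "N * M = - (W * (K * K) * \<Omega>)" by (simp add: N_def M_def assoc)
  also have "\<dots> = W * (P * \<Omega>)" by (simp add: KK assoc)
  also have "\<dots> = Q" by (simp add: PO WO flip: assoc)
  finally have NM: "N * M = Q" .
  have "M * N = - (K * (\<Omega> * W) * K)" by (simp add: N_def M_def assoc)
  then have MN: "M * N = P" by (simp add: OW KK)
  define \<tau> where "\<tau> = Z + N + M"
  have t: "\<tau> \<in> carrier_mat m m" by (simp add: \<tau>_def)
  note [simp] = t t[THEN carrier_matD(1)] t[THEN carrier_matD(2)]
  note swap = block_swap_involution[OF \<open>N \<in> _\<close> \<open>M \<in> _\<close> disj P_def Q_def Z_def QN NP PM MQ NM MN,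
      folded \<tau>_def]
  have sq: "\<tau> * \<tau> = 1\<^sub>m m" by (rule swap(1))
  \<comment> \<open>The determinant is \<open>(-1)\<^sup>k\<close> where \<open>k\<close> counts the indices of nonzero
    eigenvalues outside the upper half.\<close>
  have "even (card {i. i < m \<and> q i})"
  proof (rule even_card_if_even_fibres)
    fix \<mu>
    show "even (card {i \<in> {i. i < m \<and> q i}. d i = \<mu>})"
    proof (cases "in_upper_half (- \<mu>)")
      case True
      then have "{i \<in> {i. i < m \<and> q i}. d i = \<mu>} = {i. i < m \<and> d i = \<mu>}"
        by (auto simp: q_def)
      then show ?thesis using ev[of \<mu>] True halves(1)[of \<mu>] by simp
    next
      case False
      then have "{i \<in> {i. i < m \<and> q i}. d i = \<mu>} = {}" by (auto simp: q_def)
      then show ?thesis by (metis card.empty even_zero)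
    qed
  qed simp
  then have det: "det \<tau> = 1" using swap(2) by simp

  have S: "\<Omega> * \<tau> = \<Omega> * Z + K + - (\<Omega> * K * \<Omega>)"
    unfolding \<tau>_def N_def M_def by (simp add: dist) (simp add: OW flip: assoc)
  have Zt: "transpose_mat Z = Z" by (auto simp: Z_def mat_diag_def)
  have Ot: "transpose_mat (\<Omega> * Z) = - (\<Omega> * Z)"
    using transpose_mult[of \<Omega> m m Z m] by (simp add: anti Zt ZO)
  have OKt: "transpose_mat (\<Omega> * K * \<Omega>) = - (\<Omega> * K * \<Omega>)"
    using transpose_mult[of \<Omega> m m K m] transpose_mult[of "\<Omega> * K" m m \<Omega> m]
    by (simp add: anti Kt assoc)
  have "transpose_mat (\<Omega> * \<tau>) = - (\<Omega> * \<tau>)"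
    unfolding S
    by (subst transpose_add[of _ m m], simp, simp, subst transpose_add[of _ m m], simp, simp)
      (simp add: transpose_uminus Ot OKt Kt uminus_add_mat, auto intro!: eq_matI)
  then have "transpose_mat \<tau> * \<Omega> = \<Omega> * \<tau>"
    using transpose_mult[of \<Omega> m m \<tau> m] by (simp add: anti)
  then have sym: "transpose_mat \<tau> * \<Omega> * \<tau> = \<Omega>"
    by (simp add: assoc sq)

  have "d i * (if p i \<or> q i then 0 else 1) = 0" for i
    using halves(1)[of "d i"] by (simp add: p_def q_def)
  then have DZ: "D * Z = 0\<^sub>m m m" "Z * D = 0\<^sub>m m m"
    unfolding D_def Z_def mat_diag_diag by (auto simp: mat_diag_def mult.commute intro!: eq_matI)
  have "D * N = D * W * K" by (simp add: N_def assoc)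
  also have "\<dots> = - (N * D)" by (simp add: N_def DW assoc DK)
  finally have DN: "D * N = - (N * D)" .
  have "D * M = - (D * K * \<Omega>)" by (simp add: M_def assoc)
  also have "\<dots> = - (M * D)" by (simp add: M_def DK assoc DO)
  finally have DM: "D * M = - (M * D)" .
  have "\<tau> * D = - (D * \<tau>)"
    unfolding \<tau>_def by (simp add: dist DZ DN DM) (auto intro!: eq_matI)
  with sq det sym show thesis
    using that[of \<tau>] by (simp add: D_def)
qed

section \<open>The symplectic group and its adjoint action\<close>

lemma eq_uminus_if_add_eq_zero_mat:
  fixes A :: "'a :: group_add mat"
  assumes "A \<in> carrier_mat m k" "B \<in> carrier_mat m k" and "A + B = 0\<^sub>m m k"
  shows "A = - B"
proof (rule eq_matI)
  fix i j assume "i < dim_row (- B)" "j < dim_col (- B)"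
  moreover from this have "(A + B) $$ (i, j) = 0" using assms by simp
  ultimately show "A $$ (i, j) = (- B) $$ (i, j)" by (simp add: eq_neg_iff_add_eq_0)
qed (use assms in auto)

lemma J_mat_carrier: "J_mat n \<in> carrier_mat (2 * n) (2 * n)"
  by (auto simp: J_mat_def)

lemma transpose_J_mat: "transpose_mat (J_mat n) = - J_mat n"
  by (rule eq_matI) (auto simp: J_mat_def)

lemma J_mat_square: "J_mat n * J_mat n = - 1\<^sub>m (2 * n)"
proof -
  have "J_mat n * J_mat n = four_block_mat (- 1\<^sub>m n) (0\<^sub>m n n) (0\<^sub>m n n) (- 1\<^sub>m n)"
    unfolding J_mat_def
    by (subst mult_four_block_mat[of _ n n _ n _ n _ _ n _ n]) auto
  also have "\<dots> = - 1\<^sub>m (2 * n)"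
    by (rule eq_matI) auto
  finally show ?thesis .
qed

lemma Ad_involution:
  assumes g: "g \<in> carrier_mat m m" and gg: "g * g = 1\<^sub>m m"
  shows "Ad g X = g * X * g"
proof -
  have "g \<in> Units (ring_mat TYPE(complex) m ())"
    using g gg by (auto simp: Units_def ring_mat_def)
  then obtain B where B: "mat_inverse g = Some B"
    using mat_inverse(1)[OF g, of "()"] by (cases "mat_inverse g") auto
  then have "B \<in> carrier_mat m m" "g * B = 1\<^sub>m m" using mat_inverse(2)[OF g] by auto
  then have "B = g" using g gg assoc_mult_mat[of g m m g m B m] by simp
  then show ?thesis by (simp add: Ad_def B)
qed

text \<open>
  An involution is its own inverse, so \<open>- H = g H g\<^sup>-\<^sup>1\<close> turns into anticommutation with \<open>g\<close>.
\<close>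

lemma strongly_Ad_real_iff:
  assumes H: "H \<in> carrier_mat (2 * n) (2 * n)"
  shows "strongly_Ad_real (Sp_complex n) H \<longleftrightarrow>
    (\<exists>g\<in>Sp_complex n. g * g = 1\<^sub>m (2 * n) \<and> g * H = - (H * g))"
proof -
  have "- H = Ad g H \<longleftrightarrow> g * H = - (H * g)"
    if "g \<in> Sp_complex n" and gg: "g * g = 1\<^sub>m (2 * n)" for g
  proof -
    have g: "g \<in> carrier_mat (2 * n) (2 * n)" using that by (simp add: Sp_complex_def SL_complex_def)
    have cancel: "A * g * g = A" if "A \<in> carrier_mat (2 * n) (2 * n)" for A
      using that g gg by (simp add: assoc_mult_mat[of _ "2 * n" "2 * n" _ "2 * n" _ "2 * n"])
    have "- H = g * H * g \<longleftrightarrow> - H * g = g * H"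
      using cancel[of "- H"] cancel[of "g * H"] g H by (metis mult_carrier_mat uminus_carrier_mat)
    then show ?thesis using Ad_involution[OF g gg, of H] g H by auto
  qed
  moreover have "g ^\<^sub>m 2 = g * g" if "g \<in> Sp_complex n" for g
    using that by (simp add: Sp_complex_def SL_complex_def numeral_2_eq_2)
  ultimately show ?thesis
    using H by (auto simp: strongly_Ad_real_def Ad_real_def)
qed

section \<open>Strongly real semisimple elements\<close>

theorem theorem3p12:
  fixes n :: nat and H :: "complex mat"
  assumes "n > 0"
    and "H \<in> sp_complex n"
    and "diagonalizable_mat H"
  shows "strongly_Ad_real (Sp_complex n) H \<longleftrightarrow>
    (\<forall>\<mu>. eigenvalue H \<mu> \<and> \<mu> \<noteq> 0 \<longrightarrow> even (eigenvalue_mult H \<mu>))"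
proof -
  let ?m = "2 * n" and ?J = "J_mat n"
  note [simp] = J_mat_carrier
  note [simp] = mult_carrier_mat[of _ ?m ?m _ ?m]
  note assoc = assoc_mult_mat[of _ ?m ?m _ ?m _ ?m]
  have H[simp]: "H \<in> carrier_mat ?m ?m" and HJ0: "transpose_mat H * ?J + ?J * H = 0\<^sub>m ?m ?m"
    using assms(2) by (auto simp: sp_complex_def sl_complex_def)
  note [simp] = J_mat_carrier[THEN carrier_matD(1)] J_mat_carrier[THEN carrier_matD(2)]
    H[THEN carrier_matD(1)] H[THEN carrier_matD(2)]
  have HJ: "transpose_mat H * ?J = - (?J * H)"
    using eq_uminus_if_add_eq_zero_mat[OF _ _ HJ0] by simp
  obtain D where "diagonal_mat D" and sim: "similar_mat H D"
    using assms(3) by (auto simp: diagonalizable_mat_def)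
  then obtain R V where R[simp]: "R \<in> carrier_mat ?m ?m" and V[simp]: "V \<in> carrier_mat ?m ?m"
    and D[simp]: "D \<in> carrier_mat ?m ?m" and RV: "R * V = 1\<^sub>m ?m" and VR: "V * R = 1\<^sub>m ?m"
    and HD: "H = R * D * V"
    unfolding similar_mat_def by (meson similar_mat_witD2 H)
  note [simp] = R[THEN carrier_matD(1)] R[THEN carrier_matD(2)] V[THEN carrier_matD(1)]
    V[THEN carrier_matD(2)] D[THEN carrier_matD(1)] D[THEN carrier_matD(2)]
  define d where "d i = D $$ (i, i)" for i
  have Dd: "D = mat_diag ?m d"
    using \<open>diagonal_mat D\<close> D by (auto simp: mat_diag_def diagonal_mat_def d_def intro!: eq_matI)
  have mult: "eigenvalue_mult H \<mu> = card {i. i < ?m \<and> d i = \<mu>}" for \<mu>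
    unfolding eigenvalue_mult_def using order_char_poly_similar_mat_diag sim Dd by blast
  have eig: "eigenvalue H \<mu>" if "eigenvalue_mult H \<mu> \<noteq> 0" for \<mu>
    using that by (metis H eigenvalue_mult_def eigenvalue_root_char_poly order_0I)
  have RtVt: "transpose_mat R * transpose_mat V = 1\<^sub>m ?m"
    and VtRt: "transpose_mat V * transpose_mat R = 1\<^sub>m ?m"
    by (metis VR RV V R transpose_mult transpose_one)+
  have cancelV: "V * (R * X) = X"
    and cancelR: "R * (V * X) = X" "transpose_mat V * (transpose_mat R * X) = X"
    if "X \<in> carrier_mat ?m ?m" for X
    using that by (simp_all add: VR RV VtRt flip: assoc)
  have JJ: "?J * (?J * X) = - X" if "X \<in> carrier_mat ?m ?m" for X
    using that by (simp add: J_mat_square flip: assoc)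
  have HR: "H * R = R * D" by (simp add: HD assoc VR)
  have Dt: "transpose_mat D = D" by (auto simp: Dd mat_diag_def)
  have DR: "D * transpose_mat R = transpose_mat R * transpose_mat H"
    using transpose_mult[OF H R] transpose_mult[OF R D] by (simp add: HR Dt)
  have DRX: "D * (transpose_mat R * (?J * X)) = - (transpose_mat R * (?J * (H * X)))"
    if "X \<in> carrier_mat ?m ?m" for X
  proof -
    have "D * (transpose_mat R * (?J * X)) = D * transpose_mat R * ?J * X"
      using that by (simp add: assoc)
    also have "\<dots> = transpose_mat R * (transpose_mat H * ?J) * X"
      by (simp add: DR assoc)
    finally show ?thesis using that by (simp add: HJ assoc)
  qed
  show ?thesis
    unfolding strongly_Ad_real_iff[OF H]
  proof
    assume "\<exists>g\<in>Sp_complex n. g * g = 1\<^sub>m ?m \<and> g * H = - (H * g)"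
    then obtain g where g[simp]: "g \<in> carrier_mat ?m ?m" and gJg: "transpose_mat g * ?J * g = ?J"
      and gg: "g * g = 1\<^sub>m ?m" and gH: "g * H = - (H * g)"
      by (auto simp: Sp_complex_def SL_complex_def)
    note [simp] = g[THEN carrier_matD(1)] g[THEN carrier_matD(2)]
    have ggX: "g * (g * X) = X" if "X \<in> carrier_mat ?m ?m" for X
      using that by (simp add: gg flip: assoc)
    have "transpose_mat g * ?J = transpose_mat g * ?J * g * g" by (simp add: assoc gg)
    then have gJ: "transpose_mat g * ?J = ?J * g" by (simp add: gJg)
    \<comment> \<open>The matrix of \<open>(x, y) \<mapsto> \<omega>(x, g y)\<close> in the eigenbasis, and its inverse.\<close>
    define S where "S = transpose_mat R * (?J * (g * R))"
    define T where "T = - (V * (g * (?J * transpose_mat V)))"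
    have "S \<in> carrier_mat ?m ?m" "T \<in> carrier_mat ?m ?m" by (simp_all add: S_def T_def)
    moreover have "S * T = 1\<^sub>m ?m"
      by (simp add: S_def T_def assoc cancelR ggX JJ RtVt)
    moreover have "transpose_mat S = - S"
    proof -
      have "transpose_mat S = transpose_mat (g * R) * transpose_mat ?J * R"
        unfolding S_def using transpose_mult[of "transpose_mat R" ?m ?m "?J * (g * R)" ?m]
          transpose_mult[of ?J ?m ?m "g * R" ?m] by simp
      also have "\<dots> = - (transpose_mat R * (transpose_mat g * ?J) * R)"
        using transpose_mult[OF g R] by (simp add: transpose_J_mat assoc)
      also have "\<dots> = - S" by (simp add: gJ S_def assoc)
      finally show ?thesis .
    qed
    moreover have "D * S = S * D"
    proof -
      have "D * S = - (transpose_mat R * (?J * (H * (g * R))))"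
        unfolding S_def by (rule DRX) simp
      also have "H * (g * R) = - (g * H) * R" by (simp add: gH assoc)
      also have "\<dots> = - (g * (R * D))" by (simp add: assoc HR)
      finally show ?thesis by (simp add: S_def assoc)
    qed
    ultimately have "even (eigenvalue_mult H \<mu>)" for \<mu>
      unfolding mult
      by (intro even_fibre_if_antisymmetric_commutes[of S ?m T]) (simp_all flip: Dd)
    then show "\<forall>\<mu>. eigenvalue H \<mu> \<and> \<mu> \<noteq> 0 \<longrightarrow> even (eigenvalue_mult H \<mu>)"
      by blast
  next
    assume even: "\<forall>\<mu>. eigenvalue H \<mu> \<and> \<mu> \<noteq> 0 \<longrightarrow> even (eigenvalue_mult H \<mu>)"
    have ev: "even (card {i. i < ?m \<and> d i = \<mu>})" if "\<mu> \<noteq> 0" for \<mu>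
      using even eig[of \<mu>] that unfolding mult by (metis even_zero)
    \<comment> \<open>The symplectic form in the eigenbasis, and its inverse.\<close>
    define \<Omega> where "\<Omega> = transpose_mat R * (?J * R)"
    define W where "W = - (V * (?J * transpose_mat V))"
    have Om[simp]: "\<Omega> \<in> carrier_mat ?m ?m" and W: "W \<in> carrier_mat ?m ?m"
      by (simp_all add: \<Omega>_def W_def)
    have OW: "\<Omega> * W = 1\<^sub>m ?m"
      by (simp add: \<Omega>_def W_def assoc cancelR JJ RtVt)
    then have WO: "W * \<Omega> = 1\<^sub>m ?m"
      using mat_mult_left_right_inverse[OF Om W] by simp
    have anti: "transpose_mat \<Omega> = - \<Omega>"
      unfolding \<Omega>_def using transpose_mult[of "transpose_mat R" ?m ?m "?J * R" ?m]
        transpose_mult[of ?J ?m ?m R ?m] by (simp add: transpose_J_mat assoc)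
    have rev: "mat_diag ?m d * \<Omega> = - (\<Omega> * mat_diag ?m d)"
      using DRX[OF R] by (simp add: \<Omega>_def assoc HR flip: Dd)
    obtain \<tau> where t[simp]: "\<tau> \<in> carrier_mat ?m ?m" and tt: "\<tau> * \<tau> = 1\<^sub>m ?m"
      and dt: "det \<tau> = 1" and sp: "transpose_mat \<tau> * \<Omega> * \<tau> = \<Omega>"
      and tD: "\<tau> * D = - (D * \<tau>)"
      using symplectic_sign_reversing_involution[OF Om W OW WO anti rev ev] unfolding Dd by blast
    note [simp] = t[THEN carrier_matD(1)] t[THEN carrier_matD(2)]
    have ttX: "\<tau> * (\<tau> * X) = X" if "X \<in> carrier_mat ?m ?m" for X
      using that by (simp add: tt flip: assoc)
    \<comment> \<open>Back from the eigenbasis to the standard basis.\<close>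
    define g where "g = R * (\<tau> * V)"
    have g[simp]: "g \<in> carrier_mat ?m ?m" by (simp add: g_def)
    have "det R * det V = 1" using det_mult[OF R V] by (simp add: RV)
    then have "det g = 1"
      unfolding g_def using det_mult[of R ?m "\<tau> * V"] det_mult[OF t V] by (simp add: dt)
    moreover have "transpose_mat g * ?J * g = ?J"
    proof -
      have "transpose_mat g = transpose_mat V * (transpose_mat \<tau> * transpose_mat R)"
        unfolding g_def using transpose_mult[of R ?m ?m "\<tau> * V" ?m] transpose_mult[OF t V]
        by (simp add: assoc)
      then have "transpose_mat g * ?J * g = transpose_mat V * (transpose_mat \<tau> * \<Omega> * \<tau>) * V"
        by (simp add: g_def \<Omega>_def assoc)
      also have "\<dots> = ?J"
        unfolding sp by (simp add: \<Omega>_def assoc RV cancelR)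
      finally show ?thesis .
    qed
    ultimately have "g \<in> Sp_complex n" by (simp add: Sp_complex_def SL_complex_def)
    moreover have "g * g = 1\<^sub>m ?m" by (simp add: g_def assoc cancelV ttX RV)
    moreover have "g * H = - (H * g)"
    proof -
      have "g * H = R * (\<tau> * D) * V" by (simp add: g_def HD assoc cancelV)
      also have "\<dots> = - (H * g)" unfolding tD by (simp add: g_def HD assoc cancelV)
      finally show ?thesis .
    qed
    ultimately show "\<exists>g\<in>Sp_complex n. g * g = 1\<^sub>m ?m \<and> g * H = - (H * g)" by blast
  qed
qed

end
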